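(* Let $(x_a^{(h)})$ and $(y_a^{(h)})$, $a\in\{1,\dots,\mathsf N\}$, $h\in\{0,\dots,p-1\}$, be arbitrary complex numbers and let $$\langle x|=\sum_{h_1,\dots,h_{\mathsf N}=0}^{p-1}\prod_{a=1}^{\mathsf N}x_a^{(h_a)}\prod_{1\le b<a\le\mathsf N}(X_a^{(h_a)}-X_b^{(h_b)})\,\langle\beta/q^2,h_1,\dots,h_{\mathsf N}|,$$ $$|y\rangle=\sum_{h_1,\dots,h_{\mathsf N}=0}^{p-1}\prod_{a=1}^{\mathsf N}y_a^{(h_a)}\prod_{1\le b<a\le\mathsf N}(X_a^{(h_a)}-X_b^{(h_b)})\,|\beta,h_1,\dots,h_{\mathsf N}\rangle$$ be the corresponding left and right separate states, written in the left and right SoV bases. Then $$\langle x|y\rangle=\det\mathcal M^{(x,y)},$$ where $\mathcal M^{(x,y)}$ is the $\mathsf N\times\mathsf N$ matrix with entries $$\mathcal M^{(x,y)}_{a,b}=\sum_{h=0}^{p-1}x_a^{(h)}\,y_a^{(h)}\,(X_a^{(h)})^{b-1},\qquad a,b\in\{1,\dots,\mathsf N\}.$$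
   Context: Setting. $\mathsf N\ge1$, $p=2l+1$ odd, $q=e^{-i\pi p'/p}$ with $p'$ even and coprime to $p$; $\mathcal H=\otimes_{n=1}^{\mathsf N}\mathcal R_n$ with $\dim\mathcal R_n=p$ is the representation space of the cyclic 6-vertex reflection algebra, and $\mathcal B_-(\lambda|\beta)$ is the gauge transformed generator of that algebra with gauge parameter $\beta$ (for generic parameters). The left and right SoV bases of $\mathcal H$ are bases $\langle\beta',\mathbf h|$ of covectors and $|\beta',\mathbf h\rangle$ of vectors, $\mathbf h=(h_1,\dots,h_{\mathsf N})\in\{0,\dots,p-1\}^{\mathsf N}$, $\beta'\in\{\beta q^{2j}\}_{j\in\mathbb Z}$, which pseudo-diagonalize this operator family: $$\langle\beta',\mathbf h|\mathcal B_-(\lambda|\beta')=\mathsf b_{\mathbf h}(\lambda|\beta')\langle\beta'/q^2,\mathbf h|,\qquad\mathcal B_-(\lambda|\beta')|\beta',\mathbf h\rangle=|q^2\beta',\mathbf h\rangle\,\mathsf b_{\mathbf h}(\lambda|\beta'),$$ $$\mathsf b_{\mathbf h}(\lambda|\beta')=\mathsf b_-(\beta')\Big(\frac{\lambda^2}q-\frac q{\lambda^2}\Big)\prod_{a=1}^{\mathsf N}\Big(\frac{\lambda}{\mathsf b_aq^{h_a}}-\frac{\mathsf b_aq^{h_a}}{\lambda}\Big)\Big(\lambda q^{h_a}\mathsf b_a-\frac1{\lambda q^{h_a}\mathsf b_a}\Big),$$ for nonzero complex numbers $\mathsf b_-(\beta'),\mathsf b_1,\dots,\mathsf b_{\mathsf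 N}$ with $\mathsf b_n^{2p}\neq\pm1$ and the numbers $X_a^{(h)}$ below, for different $a$, pairwise distinct. Notation: $$X_a^{(h)}=(\mathsf b_aq^h)^2+(\mathsf b_aq^h)^{-2}.$$ The bases are normalized so that $$\langle\beta/q^2,\mathbf h|\beta,\mathbf k\rangle=\prod_{a=1}^{\mathsf N}\delta_{h_a,k_a}\prod_{1\le b<a\le\mathsf N}\frac1{X_a^{(h_a)}-X_b^{(h_b)}}.$$ $\langle x|y\rangle$ is the natural pairing of the covector $\langle x|$ with the vector $|y\rangle$. *)

theory Defs
  imports
    Complex_Main
    "HOL-Library.FuncSet"
    "HOL-Library.Function_Algebras"
    "Jordan_Normal_Form.Determinant"
begin

definition basis_family ::
  "(complex \<Rightarrow> 'v \<Rightarrow> 'v) \<Rightarrow> 'v::ab_group_add set \<Rightarrow> 'i set \<Rightarrow> ('i \<Rightarrow> 'v) \<Rightarrow> bool" where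
  "basis_family scale S J e \<longleftrightarrow>
     inj_on e J \<and> \<not> module.dependent scale (e ` J) \<and> module.span scale (e ` J) = S"

text \<open>A tensor product of the spaces \<open>R n\<close>, \<open>n \<in> I\<close>, for finite \<open>I\<close>, given by its canonical map
  \<open>T\<close> from families \<open>(w n)\<close> to \<open>\<Otimes> w n\<close>: this map is multilinear, and for any choice of bases of
  the factors the products of basis vectors form a basis of the whole space \<open>'v\<close>.\<close>

definition is_tensor_product ::
  "(complex \<Rightarrow> 'r \<Rightarrow> 'r) \<Rightarrow> nat set \<Rightarrow> (nat \<Rightarrow> 'r::ab_group_add set) \<Rightarrow>
   (complex \<Rightarrow> 'v \<Rightarrow> 'v) \<Rightarrow> ((nat \<Rightarrow> 'r) \<Rightarrow> 'v::ab_group_add) \<Rightarrow> bool" where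
  "is_tensor_product scale_R I R scale T \<longleftrightarrow>
     (\<forall>w \<in> Pi\<^sub>E I R. \<forall>n \<in> I. \<forall>u \<in> R n. \<forall>u' \<in> R n. \<forall>c.
        T (w(n := scale_R c u + u')) = scale c (T (w(n := u))) + T (w(n := u'))) \<and>
     (\<forall>E. (\<forall>n \<in> I. basis_family scale_R (R n) (E n) (\<lambda>v. v)) \<longrightarrow>
        basis_family scale UNIV (Pi\<^sub>E I E) T)"

text \<open>Covectors are linear functionals; the pairing of a covector with a vector is evaluation.\<close>

definition covectors :: "(complex \<Rightarrow> 'v \<Rightarrow> 'v) \<Rightarrow> ('v::ab_group_add \<Rightarrow> complex) set" where
  "covectors scale = {f. Vector_Spaces.linear scale (*) f}"

definition covector_scale :: "complex \<Rightarrow> ('v \<Rightarrow> complex) \<Rightarrow> 'v \<Rightarrow> complex" where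
  "covector_scale c f = (\<lambda>v. c * f v)"

definition root_q :: "int \<Rightarrow> nat \<Rightarrow> complex" where
  "root_q p' p = exp (- (\<i> * of_real pi * of_int p' / of_nat p))"

definition gauge_orbit :: "complex \<Rightarrow> complex \<Rightarrow> complex set" where
  "gauge_orbit q \<beta> = {\<beta> * q powi (2 * j) | j :: int. True}"

definition configs :: "nat \<Rightarrow> nat \<Rightarrow> (nat \<Rightarrow> nat) set" where
  "configs N p = {1..N} \<rightarrow>\<^sub>E {0..p - 1}"

definition X_sov :: "complex \<Rightarrow> (nat \<Rightarrow> complex) \<Rightarrow> nat \<Rightarrow> nat \<Rightarrow> complex" where
  "X_sov q b a h = (b a * q ^ h)\<^sup>2 + (b a * q ^ h) powi (-2)"

definition b_eigenvalue ::
  "nat \<Rightarrow> complex \<Rightarrow> (complex \<Rightarrow> complex) \<Rightarrow> (nat \<Rightarrow> complex) \<Rightarrow> (nat \<Rightarrow> nat) \<Rightarrow>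
   complex \<Rightarrow> complex \<Rightarrow> complex" where
  "b_eigenvalue N q b_minus b h lam \<beta>' =
     b_minus \<beta>' * (lam\<^sup>2 / q - q / lam\<^sup>2) *
     (\<Prod>a = 1..N. (lam / (b a * q ^ h a) - b a * q ^ h a / lam) *
                  (lam * q ^ h a * b a - 1 / (lam * q ^ h a * b a)))"

definition left_separate_state ::
  "nat \<Rightarrow> nat \<Rightarrow> (nat \<Rightarrow> nat \<Rightarrow> complex) \<Rightarrow> ((nat \<Rightarrow> nat) \<Rightarrow> 'v \<Rightarrow> complex) \<Rightarrow>
   (nat \<Rightarrow> nat \<Rightarrow> complex) \<Rightarrow> 'v \<Rightarrow> complex" where
  "left_separate_state N p X bra x =
     (\<Sum>h \<in> configs N p. covector_scale
        ((\<Prod>a = 1..N. x a (h a)) * (\<Prod>a = 1..N. \<Prod>b = 1..<a. X a (h a) - X b (h b))) (bra h))"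

definition right_separate_state ::
  "(complex \<Rightarrow> 'v \<Rightarrow> 'v) \<Rightarrow> nat \<Rightarrow> nat \<Rightarrow> (nat \<Rightarrow> nat \<Rightarrow> complex) \<Rightarrow>
   ((nat \<Rightarrow> nat) \<Rightarrow> 'v::comm_monoid_add) \<Rightarrow> (nat \<Rightarrow> nat \<Rightarrow> complex) \<Rightarrow> 'v" where
  "right_separate_state scale N p X ket y =
     (\<Sum>h \<in> configs N p. scale
        ((\<Prod>a = 1..N. y a (h a)) * (\<Prod>a = 1..N. \<Prod>b = 1..<a. X a (h a) - X b (h b))) (ket h))"

text \<open>Matrices are indexed from 0: the entry at \<open>(i, j)\<close> is the one for \<open>a = i + 1\<close>, \<open>b = j + 1\<close>.\<close>

definition M_matrix ::
  "nat \<Rightarrow> nat \<Rightarrow> (nat \<Rightarrow> nat \<Rightarrow> complex) \<Rightarrow> (nat \<Rightarrow> nat \<Rightarrow> complex) \<Rightarrow> (nat \<Rightarrow> nat \<Rightarrow> complex) \<Rightarrow>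
   complex mat" where
  "M_matrix N p X x y =
     mat N N (\<lambda>(i, j). \<Sum>h = 0..p - 1. x (i + 1) h * y (i + 1) h * X (i + 1) h ^ j)"

end

theory Submission
  imports Defs
begin

text \<open>Expanding \<open>\<langle>x|y\<rangle>\<close> by bilinearity, the diagonal normalization cancels one of the two
  Vandermonde products and leaves a single sum over the configurations \<open>h\<close> of
  \<open>\<Prod>a. x a (h a) * y a (h a)\<close> times the Vandermonde determinant of the nodes \<open>X a (h a)\<close>.
  Multilinearity of the determinant in the rows turns this sum into the determinant of the
  matrix whose row \<open>a\<close> is summed over \<open>h a\<close>.\<close>

text \<open>Every Leibniz term takes exactly one entry from each row, so it carries each factor
  \<open>c i\<close> exactly once.\<close>

lemma det_scale_rows:
  fixes c :: "nat \<Rightarrow> 'a::comm_ring_1"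
  shows "det (mat n n (\<lambda>(i, j). c i * v i j)) = (\<Prod>i<n. c i) * det (mat n n (\<lambda>(i, j). v i j))"
proof -
  have "det (mat n n (\<lambda>(i, j). c i * v i j)) =
      (\<Sum>\<pi> | \<pi> permutes {0..<n}. signof \<pi> * (\<Prod>i = 0..<n. c i * v i (\<pi> i)))"
    by (subst det_def'[where n = n])
      (auto intro!: sum.cong prod.cong arg_cong2[where f = "(*)"] simp: permutes_def)
  also have "\<dots> = (\<Prod>i<n. c i) * (\<Sum>\<pi> | \<pi> permutes {0..<n}. signof \<pi> * (\<Prod>i = 0..<n. v i (\<pi> i)))"
    by (simp add: prod.distrib sum_distrib_left mult_ac lessThan_atLeast0)
  also have "(\<Sum>\<pi> | \<pi> permutes {0..<n}. signof \<pi> * (\<Prod>i = 0..<n. v i (\<pi> i))) =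
      det (mat n n (\<lambda>(i, j). v i j))"
    by (subst det_def'[where n = n]) (auto intro!: sum.cong prod.cong arg_cong2[where f = "(*)"])
  finally show ?thesis .
qed

text \<open>Each Leibniz term is a product of row sums. Distributing it gives one summand per choice
  function, and exchanging this sum with the one over permutations collects a determinant for each
  choice. With \<open>Suc i\<close> the choice functions live on \<open>{1..n}\<close>, as
  configurations do.\<close>

lemma det_sum_rows:
  fixes g :: "nat \<Rightarrow> 'b \<Rightarrow> nat \<Rightarrow> 'a::comm_ring_1"
  assumes "finite H"
  shows "det (mat n n (\<lambda>(i, j). \<Sum>h\<in>H. g (Suc i) h j)) =
    (\<Sum>h \<in> {1..n} \<rightarrow>\<^sub>E H. det (mat n n (\<lambda>(i, j). g (Suc i) (h (Suc i)) j)))"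
proof -
  \<comment> \<open>Rows count from 1 here while permutations act on \<open>{0..<n}\<close>, hence
    \<open>\<pi> (a - 1)\<close>.\<close>
  have shift: "(\<Prod>i = 0..<n. f (Suc i) (\<pi> i)) = (\<Prod>a = 1..n. f a (\<pi> (a - 1)))"
    for f :: "nat \<Rightarrow> nat \<Rightarrow> 'a" and \<pi>
    by (simp add: prod.atLeast1_atMost_eq lessThan_atLeast0)
  have expand: "det (mat n n (\<lambda>(i, j). v (Suc i) j)) =
      (\<Sum>\<pi> | \<pi> permutes {0..<n}. signof \<pi> * (\<Prod>a = 1..n. v a (\<pi> (a - 1))))"
    for v :: "nat \<Rightarrow> nat \<Rightarrow> 'a"
    unfolding shift[symmetric]
    by (subst det_def'[where n = n]) (auto intro!: sum.cong prod.cong arg_cong2[where f = "(*)"])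
  have "det (mat n n (\<lambda>(i, j). \<Sum>h\<in>H. g (Suc i) h j)) =
      (\<Sum>\<pi> | \<pi> permutes {0..<n}. \<Sum>h \<in> {1..n} \<rightarrow>\<^sub>E H.
         signof \<pi> * (\<Prod>a = 1..n. g a (h a) (\<pi> (a - 1))))"
    unfolding expand[of "\<lambda>a j. \<Sum>h\<in>H. g a h j"]
    by (subst prod_sum_PiE) (simp_all add: assms sum_distrib_left)
  also have "\<dots> = (\<Sum>h \<in> {1..n} \<rightarrow>\<^sub>E H. det (mat n n (\<lambda>(i, j). g (Suc i) (h (Suc i)) j)))"
    unfolding expand[of "\<lambda>a j. g a (_ a) j"] by (rule sum.swap)
  finally show ?thesis .
qed

text \<open>Multiplying by the unitriangular coefficient matrix of the Newton polynomials
  \<open>\<Prod>k<j. (T - z k)\<close> makes the Vandermonde matrix lower triangular.\<close>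

lemma det_vandermonde:
  fixes z :: "nat \<Rightarrow> 'a::idom"
  shows "det (mat n n (\<lambda>(i, j). z i ^ j)) = (\<Prod>i<n. \<Prod>j<i. z i - z j)"
proof -
  define P where "P j = (\<Prod>k<j. [:- z k, 1:])" for j
  have deg: "degree (P j) = j" for j
    unfolding P_def by (subst degree_prod_sum_eq) auto
  have lead: "coeff (P j) j = 1" for j
    using deg[of j] lead_coeff_prod[of "\<lambda>k. [:- z k, 1:]" "{..<j}"] by (simp add: P_def)
  have eval: "poly (P j) t = (\<Prod>k<j. t - z k)" for j t
    by (simp add: P_def poly_prod)
  define V where "V = mat n n (\<lambda>(i, j). z i ^ j)"
  define U where "U = mat n n (\<lambda>(k, j). coeff (P j) k)"
  have carr: "V \<in> carrier_mat n n" "U \<in> carrier_mat n n" by (auto simp: V_def U_def)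
  \<comment> \<open>Coefficients beyond the degree vanish, and monicity of \<open>P j\<close> puts 1
    on the diagonal.\<close>
  have "upper_triangular U"
    by (auto simp: U_def upper_triangular_def deg intro!: coeff_eq_0)
  then have "det U = prod_list (diag_mat U)"
    by (rule det_upper_triangular) (rule carr)
  also have "\<dots> = 1"
    by (simp add: U_def prod_list_diag_prod lead)
  finally have det_U: "det U = 1" .
  \<comment> \<open>Powers of \<open>z i\<close> against the coefficients of \<open>P j\<close>
    evaluate \<open>P j\<close> at \<open>z i\<close>; since \<open>j < n\<close>, the matrix size
    cuts off no coefficient.\<close>
  have prod_entry: "(V * U) $$ (i, j) = (\<Prod>k<j. z i - z k)" if "i < n" "j < n" for i j
  proof -
    have "(V * U) $$ (i, j) = (\<Sum>k = 0..<n. coeff (P j) k * z i ^ k)"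
      using that by (simp add: V_def U_def scalar_prod_def mult.commute)
    also have "\<dots> = (\<Sum>k\<le>j. coeff (P j) k * z i ^ k)"
      using that by (intro sum.mono_neutral_right) (auto simp: deg intro!: coeff_eq_0)
    also have "\<dots> = poly (P j) (z i)"
      by (simp add: poly_altdef deg)
    finally show ?thesis by (simp add: eval)
  qed
  have VU: "V * U \<in> carrier_mat n n" using carr by simp
  \<comment> \<open>Above the diagonal, \<open>i < j\<close>, the entry contains the vanishing
    factor \<open>k = i\<close>.\<close>
  have "det (V * U) = prod_list (diag_mat (V * U))"
    by (rule det_lower_triangular[OF _ VU]) (auto simp: prod_entry)
  also have "\<dots> = (\<Prod>i<n. \<Prod>j<i. z i - z j)"
    using carrier_matD(1)[OF carr(1)]
    by (simp add: prod_list_diag_prod prod_entry flip: lessThan_atLeast0)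
  finally show ?thesis
    using det_mult[OF carr] det_U by (simp add: V_def)
qed

text \<open>Once a configuration is chosen, row \<open>a\<close> is the scalar
  \<open>x a (h a) * y a (h a)\<close> times the powers of \<open>X a (h a)\<close>; pulling out
  these scalars leaves a Vandermonde matrix.\<close>

lemma det_M_matrix:
  "det (M_matrix N p X x y) =
    (\<Sum>h \<in> configs N p. (\<Prod>a = 1..N. x a (h a) * y a (h a)) *
      (\<Prod>a = 1..N. \<Prod>a' = 1..<a. X a (h a) - X a' (h a')))"
proof -
  have shift: "(\<Prod>a' = Suc 0..<Suc k. f a') = (\<Prod>j<k. f (Suc j))" for k and f :: "nat \<Rightarrow> complex"
    unfolding atLeastLessThanSuc_atLeastAtMost by (rule prod.atLeast1_atMost_eq)
  have "det (mat N N (\<lambda>(i, j). x (Suc i) (h (Suc i)) * y (Suc i) (h (Suc i)) * X (Suc i) (h (Suc i)) ^ j)) =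
      (\<Prod>a = 1..N. x a (h a) * y a (h a)) *
      (\<Prod>a = 1..N. \<Prod>a' = 1..<a. X a (h a) - X a' (h a'))" for h
    unfolding det_scale_rows[where c = "\<lambda>i. x (Suc i) (h (Suc i)) * y (Suc i) (h (Suc i))"]
      det_vandermonde One_nat_def prod.atLeast1_atMost_eq shift ..
  then show ?thesis
    using det_sum_rows[of "{0..p - 1}" N "\<lambda>a h j. x a h * y a h * X a h ^ j"]
    by (simp add: M_matrix_def configs_def)
qed

lemma basis_family_mem:
  assumes "Modules.module scale" "basis_family scale S J e" "j \<in> J"
  shows "e j \<in> S"
  using assms Modules.module.span_superset[of scale "e ` J"] by (auto simp: basis_family_def)

lemma module_covector_scale: "Modules.module covector_scale"
  by standard (auto simp: covector_scale_def fun_eq_iff algebra_simps)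

theorem proposition4p1:
  fixes N l p :: nat and p' :: int and q \<beta> :: complex
    and scale_R :: "complex \<Rightarrow> 'r::ab_group_add \<Rightarrow> 'r"
    and R :: "nat \<Rightarrow> 'r set"
    and scale :: "complex \<Rightarrow> 'v::ab_group_add \<Rightarrow> 'v"
    and tensor :: "(nat \<Rightarrow> 'r) \<Rightarrow> 'v"
    and B :: "complex \<Rightarrow> complex \<Rightarrow> 'v \<Rightarrow> 'v"
    and bra :: "complex \<Rightarrow> (nat \<Rightarrow> nat) \<Rightarrow> 'v \<Rightarrow> complex"
    and ket :: "complex \<Rightarrow> (nat \<Rightarrow> nat) \<Rightarrow> 'v"
    and b_minus :: "complex \<Rightarrow> complex" and b :: "nat \<Rightarrow> complex"
    and X x y :: "nat \<Rightarrow> nat \<Rightarrow> complex"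
  assumes "N \<ge> 1" and "p = 2 * l + 1"
    and "even p'" and "coprime p' (int p)" and "q = root_q p' p"
    \<comment> \<open>the representation space\<close>
    and "vector_space scale_R"
    and "\<And>n. n \<in> {1..N} \<Longrightarrow> module.subspace scale_R (R n)"
    and "\<And>n. n \<in> {1..N} \<Longrightarrow> vector_space.dim scale_R (R n) = p"
    and "vector_space scale"
    and "is_tensor_product scale_R {1..N} R scale tensor"
    \<comment> \<open>the SoV bases, pseudo-diagonalizing the operator family\<close>
    and "\<And>lam \<beta>'. lam \<noteq> 0 \<Longrightarrow> \<beta>' \<in> gauge_orbit q \<beta> \<Longrightarrow> Vector_Spaces.linear scale scale (B lam \<beta>')"
    and "\<And>\<beta>'. \<beta>' \<in> gauge_orbit q \<beta> \<Longrightarrow>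
           basis_family covector_scale (covectors scale) (configs N p) (bra \<beta>')"
    and "\<And>\<beta>'. \<beta>' \<in> gauge_orbit q \<beta> \<Longrightarrow> basis_family scale UNIV (configs N p) (ket \<beta>')"
    and "\<And>lam \<beta>' h. lam \<noteq> 0 \<Longrightarrow> \<beta>' \<in> gauge_orbit q \<beta> \<Longrightarrow> h \<in> configs N p \<Longrightarrow>
           bra \<beta>' h \<circ> B lam \<beta>' =
             covector_scale (b_eigenvalue N q b_minus b h lam \<beta>') (bra (\<beta>' / q\<^sup>2) h)"
    and "\<And>lam \<beta>' h. lam \<noteq> 0 \<Longrightarrow> \<beta>' \<in> gauge_orbit q \<beta> \<Longrightarrow> h \<in> configs N p \<Longrightarrow>
           B lam \<beta>' (ket \<beta>' h) =
             scale (b_eigenvalue N q b_minus b h lam \<beta>') (ket (q\<^sup>2 * \<beta>') h)"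
    and "\<And>\<beta>'. \<beta>' \<in> gauge_orbit q \<beta> \<Longrightarrow> b_minus \<beta>' \<noteq> 0"
    and "\<And>n. n \<in> {1..N} \<Longrightarrow> b n \<noteq> 0"
    and "\<And>n. n \<in> {1..N} \<Longrightarrow> b n ^ (2 * p) \<noteq> 1 \<and> b n ^ (2 * p) \<noteq> -1"
    and "X = X_sov q b"
    and "\<And>a a' h h'. a \<in> {1..N} \<Longrightarrow> a' \<in> {1..N} \<Longrightarrow> a \<noteq> a' \<Longrightarrow> h \<in> {0..p - 1} \<Longrightarrow> h' \<in> {0..p - 1} \<Longrightarrow>
           X a h \<noteq> X a' h'"
    \<comment> \<open>normalization of the bases\<close>
    and "\<And>h k. h \<in> configs N p \<Longrightarrow> k \<in> configs N p \<Longrightarrow>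
           bra (\<beta> / q\<^sup>2) h (ket \<beta> k) =
             (\<Prod>a = 1..N. if h a = k a then 1 else 0) *
             (\<Prod>a = 1..N. \<Prod>a' = 1..<a. 1 / (X a (h a) - X a' (h a')))"
  shows "left_separate_state N p X (bra (\<beta> / q\<^sup>2)) x
           (right_separate_state scale N p X (ket \<beta>) y) =
         det (M_matrix N p X x y)"
proof -
  note norm = assms(21)
  let ?C = "configs N p"
  let ?D = "\<lambda>h. \<Prod>a = 1..N. \<Prod>a' = 1..<a. X a (h a) - X a' (h a')"
  have "q \<noteq> 0" using assms(5) by (simp add: root_q_def)
  \<comment> \<open>The orbit index is \<open>j = -1\<close>. The covectors at the shifted parameter
    thus form a basis of \<open>covectors scale\<close>, which makes each of them linear.\<close>
  then have "\<beta> / q\<^sup>2 \<in> gauge_orbit q \<beta>"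
    unfolding gauge_orbit_def
    by (intro CollectI exI[of _ "-1"]) (simp add: power_int_minus divide_inverse)
  then have lin: "Vector_Spaces.linear scale (*) (bra (\<beta> / q\<^sup>2) h)" if "h \<in> ?C" for h
    using basis_family_mem[OF module_covector_scale assms(12) that] by (simp add: covectors_def)
  have fin: "finite ?C" by (simp add: configs_def finite_PiE)
  \<comment> \<open>Only nodes of different sites are compared, and these are distinct by
    hypothesis.\<close>
  have D_nonzero: "?D h \<noteq> 0" if "h \<in> ?C" for h
    using that assms(20) by (fastforce simp: configs_def PiE_iff)
  have pairing: "bra (\<beta> / q\<^sup>2) h (ket \<beta> k) = (if h = k then 1 / ?D h else 0)"
    if "h \<in> ?C" "k \<in> ?C" for h k
  proof (cases "h = k")
    case True
    then show ?thesis using norm[OF that] by (simp add: prod_dividef)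
  next
    case False
    \<comment> \<open>Configurations are extensional, so two different ones must differ inside
      \<open>{1..N}\<close>.\<close>
    have "\<exists>a \<in> {1..N}. h a \<noteq> k a"
      using that False PiE_ext[of h "{1..N}" "\<lambda>_. {0..p - 1}" k] by (auto simp: configs_def)
    then have "(\<Prod>a = 1..N. if h a = k a then 1 else 0 :: complex) = 0"
      by (intro prod_zero) auto
    then show ?thesis using norm[OF that] False by simp
  qed
  \<comment> \<open>Only \<open>k = h\<close> survives, and the factor \<open>?D h\<close> of the
    right state cancels the normalization. The Vandermonde product of the left state is the one that
    remains.\<close>
  have apply_bra: "bra (\<beta> / q\<^sup>2) h (right_separate_state scale N p X (ket \<beta>) y) = (\<Prod>a = 1..N. y a (h a))"
    if h: "h \<in> ?C" for h
  proof -
    interpret L: Vector_Spaces.linear scale "(*)" "bra (\<beta> / q\<^sup>2) h" by (rule lin[OF h])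
    have "bra (\<beta> / q\<^sup>2) h (right_separate_state scale N p X (ket \<beta>) y) =
        (\<Sum>k \<in> ?C. if h = k then (\<Prod>a = 1..N. y a (k a)) * ?D k * (1 / ?D h) else 0)"
      unfolding right_separate_state_def L.sum L.scale
      by (rule sum.cong) (auto simp: pairing h)
    also have "\<dots> = (\<Prod>a = 1..N. y a (h a))"
      using D_nonzero[OF h] by (simp add: fin h)
    finally show ?thesis .
  qed
  \<comment> \<open>The left state is a sum of functions, which is evaluated pointwise.\<close>
  have sum_apply: "(\<Sum>h\<in>A. F h) v = (\<Sum>h\<in>A. F h v)"
    for A :: "(nat \<Rightarrow> nat) set" and F :: "_ \<Rightarrow> 'v \<Rightarrow> complex" and v
    by (induction A rule: infinite_finite_induct) auto
  have "left_separate_state N p X (bra (\<beta> / q\<^sup>2)) x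
      (right_separate_state scale N p X (ket \<beta>) y) =
      (\<Sum>h \<in> ?C. (\<Prod>a = 1..N. x a (h a) * y a (h a)) * ?D h)"
    by (simp add: left_separate_state_def sum_apply covector_scale_def apply_bra prod.distrib mult_ac)
  then show ?thesis by (simp only: det_M_matrix)
qed

end
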